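(* Let $d\ge 2$, let $\mathbb{F}_q$ be a finite field, $F=\mathbb{F}_q((1/t))$, $\mathcal{O}=\mathbb{F}_q[[1/t]]$, let $B$ be the Bruhat–Tits building of $\mathrm{PGL}_d(F)$, and let $\Gamma=\mathrm{PGL}_d(\mathbb{F}_q[t])$ act on $B$. Then the set $$T=\{[l_{\bar n}] : \bar n=(n_1,\dots,n_{d-1},0),\ n_1\ge n_2\ge\cdots\ge n_d=0\}$$ is the fundamental domain of $B$ under the action of $\Gamma$, that is: (1) $B=\bigcup_{\gamma\in\Gamma}\gamma(T)$; and (2) if $S$ is a simplex in $T$, then for any $\gamma\in\Gamma$, either $\gamma(S)\cap S=\emptyset$ or $\gamma(S)$ and $S$ coincide.
   Context: A lattice in $F^d$ is a finitely generated $\mathcal{O}$-submodule of $F^d$ that generates $F^d$ over $F$. Two lattices $L,L'$ are equivalent if $L'=aL$ for some $a\in F^\times$; $[L]$ denotes the equivalence class. The vertices of the building $B$ are the equivalence classes of lattices; its $i$-simplices are the sets of vertices $\{[L_0],\dots,[L_i]\}$ having representatives that form a chain $\frac1t L_0\subset L_i\subset\cdots\subset L_1\subset L_0$ (strict inclusions). The vertex set $B^0$ is identified with $\mathrm{PGL}_d(F)/\mathrm{PGL}_d(\mathcal{O})$, and $\mathrm{PGL}_d(F)$ acts on $B$ by $g[L]=[gL]$. For $\bar n=(n_1,\dots,n_d)$ a sequence of integers with $n_1\ge\cdots\ge n_d=0$, $l_{\bar n}=\sum_{i=1}^d t^{n_i}\mathcal{O}e_i$, where $e_1,\dots,e_d$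 is the standard basis of the column space $F^d$. $T$ is defined as a set of vertices of $B$; a simplex in $T$ is a simplex of $B$ whose vertices all lie in $T$. The conditions required for an open connected subset $X'$ of $B$ to be the fundamental domain of $B$ under the action of a group $\Gamma$ are: $B=\bigcup_{\gamma\in\Gamma}\gamma(X')$; and, for every simplex $S$ in $X'$ and every $\gamma\in\Gamma$, either $\gamma(S)\cap S=\emptyset$ or $S$ and $\gamma(S)$ coincide.
   Formalization: Condition (2) fails for simplices as vertex sets (γ may fix one vertex of an edge and move the other out); it is proved for open simplices: γ(S) and S are disjoint or coincide pointwise, and any vertex of S that γ sends into S is fixed. *)

theory Defs
  imports "HOL-Analysis.Analysis" "HOL-Computational_Algebra.Formal_Laurent_Series"
begin

text \<open>
  Throughout, \<open>F\<close> is \<^typ>\<open>'a fls\<close>, the field of formal Laurent series over a finite field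
  \<^typ>\<open>'a\<close>, with indeterminate \<^term>\<open>fls_X\<close> standing for \<open>1/t\<close>; hence \<open>t\<close> is \<^term>\<open>fls_X_inv\<close>
  and the ring of integers \<open>\<O>\<close> is \<^typ>\<open>'a fps\<close>, embedded by \<^const>\<open>fps_to_fls\<close>.
  The coordinates are indexed by a finite linearly ordered type \<^typ>\<open>'d\<close>, whose cardinality is \<open>d\<close>
  and whose largest element plays the role of the last index \<open>d\<close>.
\<close>

section \<open>Lattices and the building\<close>

interpretation Omod: module "\<lambda>(c::'a::field fps) (v::'a fls ^ 'd::finite). fps_to_fls c *s v"
  by unfold_locales
    (simp_all only: vector_add_ldistrib fps_to_fls_plus vector_sadd_rdistrib vector_smult_assoc
       fls_times_fps_to_fls fps_one_to_fls vector_smult_lid)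

definition is_lattice :: "('a::field fls ^ 'd::finite) set \<Rightarrow> bool" where
  "is_lattice L \<longleftrightarrow> (\<exists>A. finite A \<and> L = Omod.span A) \<and> vec.span L = UNIV"

definition scale_lattice :: "'a::field fls \<Rightarrow> ('a fls ^ 'd) set \<Rightarrow> ('a fls ^ 'd) set" where
  "scale_lattice a L = (\<lambda>v. a *s v) ` L"

definition lattice_class :: "('a::field fls ^ 'd) set \<Rightarrow> ('a fls ^ 'd) set set" where
  "lattice_class L = {scale_lattice a L | a. a \<noteq> 0}"

definition vertices :: "('a::field fls ^ 'd::finite) set set set" where
  "vertices = lattice_class ` {L. is_lattice L}"

text \<open>A simplex is identified with its (nonempty) set of vertices.\<close>

definition simplices :: "('a::field fls ^ 'd::finite) set set set set" where
  "simplices = {S. \<exists>(i::nat) L.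
      S = (\<lambda>k. lattice_class (L k)) ` {..i} \<and>
      (\<forall>k\<le>i. is_lattice (L k)) \<and>
      (\<forall>k<i. L (Suc k) \<subset> L k) \<and>
      scale_lattice (1 / fls_X_inv) (L 0) \<subset> L i}"

section \<open>The action of the projective linear group\<close>

text \<open>The elements of \<open>PGL\<^sub>d(F)\<close> are the cosets of \<open>GL\<^sub>d(F)\<close> modulo the nonzero scalar matrices.\<close>

definition pgl_class :: "'a::field fls ^ 'd ^ 'd::finite \<Rightarrow> ('a fls ^ 'd ^ 'd) set" where
  "pgl_class g = {mat a ** g | a. a \<noteq> 0}"

definition poly_to_fls :: "'a::field poly \<Rightarrow> 'a fls" where
  "poly_to_fls p = poly (map_poly fls_const p) fls_X_inv"

text \<open>
  The image of \<open>GL\<^sub>d(\<F>\<^sub>q[t])\<close> in \<open>PGL\<^sub>d(F)\<close>. The kernel of this map consists of the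
  scalar matrices whose entry is a unit of \<open>\<F>\<^sub>q[t]\<close>, so the image is \<open>PGL\<^sub>d(\<F>\<^sub>q[t])\<close>.
  Invertibility of \<^term>\<open>g\<close> is over the polynomial ring.
\<close>

definition PGL_poly :: "('a::field fls ^ 'd ^ 'd::finite) set set" where
  "PGL_poly = {pgl_class (\<chi> i j. poly_to_fls (g $ i $ j)) | g :: 'a poly ^ 'd ^ 'd. invertible g}"

text \<open>Product of a coset and an equivalence class; see \<open>act_class\<close>, which is \<open>g[L] = [gL]\<close>.\<close>

definition act ::
  "('a::field fls ^ 'd ^ 'd::finite) set \<Rightarrow> ('a fls ^ 'd) set set \<Rightarrow> ('a fls ^ 'd) set set" where
  "act \<gamma> V = {(\<lambda>v. g *v v) ` L | g L. g \<in> \<gamma> \<and> L \<in> V}"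

lemma mat_mult_vector: "mat a *v v = a *s (v :: 'a::comm_semiring_1 ^ 'd::finite)"
  by (simp add: vec_eq_iff matrix_vector_mult_def mat_def if_distrib if_distribR cong: if_cong)

lemma act_class: "act (pgl_class g) (lattice_class L) = lattice_class ((\<lambda>v. g *v v) ` L)"
proof -
  have eq: "(\<lambda>v. (mat a ** g) *v v) ` scale_lattice b L
      = scale_lattice (a * b) ((\<lambda>v. g *v v) ` L)" for a b
  proof -
    have "(mat a ** g) *v (b *s v) = (a * b) *s (g *v v)" for v
      by (simp only: matrix_vector_mul_assoc[symmetric] mat_mult_vector vector_scalar_commute
          vector_smult_assoc mult.commute)
    then show ?thesis by (simp add: scale_lattice_def image_image)
  qed
  show ?thesis
  proof (intro set_eqI iffI)
    fix M assume "M \<in> act (pgl_class g) (lattice_class L)"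
    then obtain a b where "a \<noteq> 0" "b \<noteq> 0" "M = (\<lambda>v. (mat a ** g) *v v) ` scale_lattice b L"
      unfolding act_def pgl_class_def lattice_class_def by blast
    then show "M \<in> lattice_class ((\<lambda>v. g *v v) ` L)"
      unfolding eq lattice_class_def using mult_eq_0_iff by blast
  next
    fix M assume "M \<in> lattice_class ((\<lambda>v. g *v v) ` L)"
    then obtain a where a: "a \<noteq> 0" "M = scale_lattice a ((\<lambda>v. g *v v) ` L)"
      unfolding lattice_class_def by blast
    have "M = (\<lambda>v. (mat a ** g) *v v) ` scale_lattice 1 L"
      unfolding eq using a by simp
    moreover have "mat a ** g \<in> pgl_class g" "scale_lattice 1 L \<in> lattice_class L"
      unfolding pgl_class_def lattice_class_def using a(1) zero_neq_one by force+
    ultimately show "M \<in> act (pgl_class g) (lattice_class L)"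
      unfolding act_def by blast
  qed
qed

section \<open>Geometric realization\<close>

text \<open>
  Points of the realization are given by barycentric coordinates. The open simplex of \<open>S\<close> consists
  of the points whose support is exactly \<open>S\<close>, and the realization of a complex is the (disjoint)
  union of its open simplices.
\<close>

definition open_simplex :: "'v set \<Rightarrow> ('v \<Rightarrow> real) set" where
  "open_simplex S = {x. (\<forall>v\<in>S. 0 < x v) \<and> (\<forall>v. v \<notin> S \<longrightarrow> x v = 0) \<and> sum x S = 1}"

definition realization :: "'v set set \<Rightarrow> ('v \<Rightarrow> real) set" where
  "realization K = (\<Union>S\<in>K. open_simplex S)"

text \<open>The affine extension of the action on vertices.\<close>

definition act_point ::
  "('a::field fls ^ 'd ^ 'd::finite) set
    \<Rightarrow> (('a fls ^ 'd) set set \<Rightarrow> real) \<Rightarrow> (('a fls ^ 'd) set set \<Rightarrow> real)" where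
  "act_point \<gamma> x = (\<lambda>w. \<Sum>v | x v \<noteq> 0 \<and> act \<gamma> v = w. x v)"

section \<open>The standard vertices\<close>

definition std_lattice :: "('d \<Rightarrow> int) \<Rightarrow> ('a::field fls ^ 'd::finite) set" where
  "std_lattice n = {\<Sum>i\<in>UNIV. (fls_X_inv powi n i * fps_to_fls (c i)) *s axis i 1 | c. True}"

definition std_vertices :: "('a::field fls ^ 'd::{finite,linorder}) set set set" where
  "std_vertices = {lattice_class (std_lattice n) | n. antimono n \<and> n (Max UNIV) = 0}"

text \<open>The full subcomplex of the building spanned by a set of vertices.\<close>

definition simplices_in ::
  "('a::field fls ^ 'd::finite) set set set \<Rightarrow> ('a fls ^ 'd) set set set set" where
  "simplices_in X = {S \<in> simplices. S \<subseteq> X}"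

text \<open>
  Covering is required of the vertices and of the whole realization.

  In the second condition, a simplex \<open>S\<close> is an open simplex of the realization. It cannot be
  read with closed simplices, or with \<open>S\<close> and \<open>\<gamma>(S)\<close> as sets of vertices: the standard vertices
  with exponents \<open>(0,\<dots>,0)\<close> and \<open>(1,0,\<dots>,0)\<close> span an edge \<open>S\<close>, and the transposition of the first
  and the last coordinate fixes the former vertex but moves the latter out of \<open>S\<close>.
  As distinct open simplices are disjoint anyway, coincidence is also required pointwise,
  and \<open>\<gamma>\<close> must not identify different vertices of \<open>S\<close>.
\<close>

definition is_fundamental_domain ::
  "('a::field fls ^ 'd ^ 'd::finite) set set \<Rightarrow> ('a fls ^ 'd) set set set \<Rightarrow> bool" where
  "is_fundamental_domain \<Gamma> X \<longleftrightarrow>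
     vertices = (\<Union>\<gamma>\<in>\<Gamma>. act \<gamma> ` X) \<and>
     realization simplices = (\<Union>\<gamma>\<in>\<Gamma>. act_point \<gamma> ` realization (simplices_in X)) \<and>
     (\<forall>S\<in>simplices_in X. \<forall>\<gamma>\<in>\<Gamma>.
        (act_point \<gamma> ` open_simplex S \<inter> open_simplex S = {} \<or>
         act_point \<gamma> ` open_simplex S = open_simplex S \<and>
           (\<forall>x\<in>open_simplex S. act_point \<gamma> x = x)) \<and>
        (\<forall>v\<in>S. act \<gamma> v \<in> S \<longrightarrow> act \<gamma> v = v))"

end

(*
  A chain of lattices, continued periodically, is a filtration of F^d. Choose vectors b_1, b_2, ... of
  F_q[t]^d successively, each one outside the F-span of the previous ones and as deep in the filtration
  as possible. Splitting coefficients into polynomial part and remainder shows that the b_j form a basis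
  of F_q[t]^d, and that a combination of the b_j lies in a step of the filtration only if each of its
  terms does. So the matrix with columns b_j is in GL_d(F_q[t]) and carries standard lattices to all
  lattices of the chain at once; their exponents are decreasing because the depths of the b_j are.

  Conversely, if a matrix g in GL_d(F_q[t]) maps the standard lattice with exponents n to a multiple
  t^e of the one with exponents m, a nonvanishing term of det g gives n <= m + e, and the inverse of g
  gives the other inequality. Hence different standard vertices lie in different orbits, and an
  element of the group that maps a simplex of T to itself fixes all its vertices.
*)

theory Submission
  imports Defs
begin

notation fls_nth (infixl "$$" 75)

section \<open>Polynomials and power series among the Laurent series\<close>

text \<open>As t is the inverse of the indeterminate, the coefficient of t^k sits at index -k. The
  linear identities below compare these coefficients.\<close>

lemma fls_nth_poly_to_fls:
  "poly_to_fls p $$ n = (if n \<le> 0 then coeff p (nat (- n)) else 0)"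
proof (induction p arbitrary: n)
  case (pCons a p)
  have "poly_to_fls (pCons a p) = fls_const a + fls_X_inv * poly_to_fls p"
    using pCons.hyps by (simp add: poly_to_fls_def map_poly_pCons)
  moreover have "coeff (pCons a p) (nat (- n)) = coeff p (nat (- (n + 1)))" if "n < 0"
    using that by (simp add: coeff_pCons nat_diff_distrib' split: nat.split)
  ultimately show ?case
    using pCons.IH by (auto simp: fls_X_inv_times_conv_shift)
qed (simp add: poly_to_fls_def)

lemma poly_to_fls_eq_iff [simp]: "poly_to_fls p = poly_to_fls q \<longleftrightarrow> p = q"
proof
  assume eq: "poly_to_fls p = poly_to_fls q"
  show "p = q"
  proof (rule poly_eqI)
    fix n
    have "poly_to_fls p $$ (- int n) = poly_to_fls q $$ (- int n)"
      by (simp only: eq)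
    then show "coeff p n = coeff q n"
      by (simp add: fls_nth_poly_to_fls)
  qed
qed simp

lemma poly_to_fls_0 [simp]: "poly_to_fls 0 = 0"
  by (simp add: poly_to_fls_def)

lemma poly_to_fls_1 [simp]: "poly_to_fls 1 = 1"
  by (simp add: poly_to_fls_def)

lemma poly_to_fls_add [simp]: "poly_to_fls (p + q) = poly_to_fls p + poly_to_fls q"
  by (rule fls_eqI) (simp add: fls_nth_poly_to_fls)

lemma poly_to_fls_diff [simp]: "poly_to_fls (p - q) = poly_to_fls p - poly_to_fls q"
  by (rule fls_eqI) (simp add: fls_nth_poly_to_fls)

lemma poly_to_fls_smult [simp]: "poly_to_fls (smult c p) = fls_const c * poly_to_fls p"
  by (rule fls_eqI) (simp add: fls_nth_poly_to_fls)

lemma poly_to_fls_pCons: "poly_to_fls (pCons a p) = fls_const a + fls_X_inv * poly_to_fls p"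
  by (cases "a = 0 \<and> p = 0") (auto simp: poly_to_fls_def map_poly_pCons)

lemma poly_to_fls_mult [simp]: "poly_to_fls (p * q) = poly_to_fls p * poly_to_fls q"
  by (induction p) (simp_all add: poly_to_fls_pCons algebra_simps)

lemma poly_to_fls_sum: "poly_to_fls (sum f A) = (\<Sum>x\<in>A. poly_to_fls (f x))"
  by (induction A rule: infinite_finite_induct) simp_all

lemma fls_subdegree_poly_to_fls: "fls_subdegree (poly_to_fls p) \<le> 0"
proof (cases "p = 0")
  case False
  then have "poly_to_fls p \<noteq> 0"
    by (metis poly_to_fls_0 poly_to_fls_eq_iff)
  then have "poly_to_fls p $$ fls_subdegree (poly_to_fls p) \<noteq> 0"
    by simp
  then show ?thesis
    by (auto simp: fls_nth_poly_to_fls split: if_splits)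
qed simp

text \<open>Only finitely many coefficients at indices at most 0 are nonzero, so they form a
  polynomial in t. The remainder, \<open>f\<close> minus this polynomial, is 0 or has subdegree at
  least 1.\<close>

lemma poly_part:
  fixes f :: "'a::field fls"
  obtains p where "\<And>n. n \<le> 0 \<Longrightarrow> poly_to_fls p $$ n = f $$ n"
proof -
  have "\<forall>\<^sub>\<infinity>n. f $$ (- int n) = 0"
    by (rule MOST_nat[THEN iffD2], rule exI[of _ "nat (- fls_subdegree f)"]) auto
  then have "coeff (Abs_poly (\<lambda>n. f $$ (- int n))) n = f $$ (- int n)" for n
    by (simp add: Abs_poly_inverse)
  then show thesis
    by (intro that[of "Abs_poly (\<lambda>n. f $$ (- int n))"]) (simp add: fls_nth_poly_to_fls)
qed

lemma range_fps_to_fls: "range fps_to_fls = {f :: 'a::zero fls. 0 \<le> fls_subdegree f}"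
proof (intro set_eqI iffI)
  fix f :: "'a fls" assume "f \<in> {f. 0 \<le> fls_subdegree f}"
  then have "f = fps_to_fls (fls_regpart f)"
    by (intro fls_eqI) auto
  then show "f \<in> range fps_to_fls"
    by blast
qed (auto simp: fls_subdegree_fls_to_fps_gt0)

text \<open>Multiplication by t^k lowers subdegrees by \<open>k\<close>, which brings
  \<open>a\<close> into the ring of integers. The case \<open>a = 0\<close> is listed separately
  because \<open>fls_subdegree 0\<close> is 0.\<close>

lemma fls_split_X_inv_powi:
  fixes a :: "'a::field fls"
  assumes "k \<le> fls_subdegree a \<or> a = 0"
  obtains u where "a = fls_X_inv powi (- k) * fps_to_fls u"
proof -
  have "0 \<le> fls_subdegree (fls_X_inv powi k * a)"
    using assms by (cases "a = 0") auto
  then obtain u where "fls_X_inv powi k * a = fps_to_fls u"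
    using range_fps_to_fls by blast
  then have "a = fls_X_inv powi (- k) * fps_to_fls u"
    by (auto simp: power_int_minus field_simps)
  then show thesis ..
qed

text \<open>This is F_q[t]^d, taken as a subset of F^d so that it can be compared with spans over F
  and with steps of a filtration.\<close>

definition poly_vectors :: "('a::field fls ^ 'd::finite) set" where
  "poly_vectors = {v. \<forall>i. v $ i \<in> range poly_to_fls}"

lemma poly_vectors_add: "v \<in> poly_vectors \<Longrightarrow> w \<in> poly_vectors \<Longrightarrow> v + w \<in> poly_vectors"
  unfolding poly_vectors_def by (auto simp del: poly_to_fls_add simp: image_iff) (metis poly_to_fls_add)

lemma poly_vectors_diff: "v \<in> poly_vectors \<Longrightarrow> w \<in> poly_vectors \<Longrightarrow> v - w \<in> poly_vectors"
  unfolding poly_vectors_def by (auto simp del: poly_to_fls_diff simp: image_iff) (metis poly_to_fls_diff)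

lemma poly_vectors_scale: "v \<in> poly_vectors \<Longrightarrow> poly_to_fls p *s v \<in> poly_vectors"
  unfolding poly_vectors_def by (auto simp del: poly_to_fls_mult simp: image_iff) (metis poly_to_fls_mult)

lemma poly_vectors_0: "0 \<in> poly_vectors"
  unfolding poly_vectors_def by (auto simp: image_iff intro: exI[of _ 0])

lemma poly_vectors_sum: "(\<And>i. i \<in> A \<Longrightarrow> f i \<in> poly_vectors) \<Longrightarrow> sum f A \<in> poly_vectors"
  by (induction A rule: infinite_finite_induct) (auto intro: poly_vectors_add poly_vectors_0)

lemma poly_vectors_axis: "axis i 1 \<in> poly_vectors"
  unfolding poly_vectors_def by (auto simp: axis_def image_iff intro: exI[of _ 0] exI[of _ 1])

section \<open>Bases of successive maxima\<close>

text \<open>The terms before \<open>k\<close> lie in the span, so if the sum did, then so would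
  \<open>a k *s b k\<close> and, after division by \<open>a k\<close>, also \<open>b k\<close>. It
  is applied at the last nonzero coefficient of a combination.\<close>

lemma sum_notin_span:
  fixes b :: "'d::{finite,linorder} \<Rightarrow> 'a::field ^ 'n::finite"
  assumes b: "b k \<notin> vec.span (b ` {..<k})"
    and a: "a k \<noteq> 0" "\<And>j. k < j \<Longrightarrow> a j = 0"
  shows "(\<Sum>j\<in>UNIV. a j *s b j) \<notin> vec.span (b ` {..<k})"
proof
  assume *: "(\<Sum>j\<in>UNIV. a j *s b j) \<in> vec.span (b ` {..<k})"
  have "(\<Sum>j\<in>UNIV. a j *s b j) = (\<Sum>j\<in>{..k}. a j *s b j)"
    using a(2) by (intro sum.mono_neutral_right) (auto simp: not_le)
  also have "\<dots> = a k *s b k + (\<Sum>j\<in>{..<k}. a j *s b j)"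
    by (subst ivl_disj_un_singleton(2)[symmetric]) (simp add: add.commute)
  finally have "a k *s b k = (\<Sum>j\<in>UNIV. a j *s b j) - (\<Sum>j\<in>{..<k}. a j *s b j)"
    by simp
  also have "\<dots> \<in> vec.span (b ` {..<k})"
    by (rule vec.span_diff[OF *]) (auto intro!: vec.span_sum vec.span_scale intro: vec.span_base)
  finally have "inverse (a k) *s (a k *s b k) \<in> vec.span (b ` {..<k})"
    by (rule vec.span_scale)
  with a(1) b show False
    by (simp add: vector_smult_assoc)
qed

lemma last_nonzero:
  fixes P :: "'d::{finite,linorder} \<Rightarrow> bool"
  assumes "P k"
  obtains l where "P l" "\<And>j. l < j \<Longrightarrow> \<not> P j"
proof -
  have "Max {j. P j} \<in> {j. P j}"
    using assms by (intro Max_in) auto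
  moreover have "\<not> P j" if "Max {j. P j} < j" for j
    using that by (metis Max_ge finite leD mem_Collect_eq)
  ultimately show thesis
    using that by blast
qed

text \<open>
  A chain of lattices \<open>(1/t) L\<^sub>0 \<subset> L\<^sub>i \<subset> \<dots> \<subset> L\<^sub>0\<close> extends periodically, with period \<open>N = i + 1\<close>, to a
  decreasing filtration of \<open>F\<^sup>d\<close> indexed by the integers.
\<close>

locale lattice_filtration =
  fixes M :: "int \<Rightarrow> ('a::field fls ^ 'd::{finite,linorder}) set" and N :: int
  assumes N_pos: "0 < N"
    and subspace: "Omod.subspace (M m)"
    and antimono: "l \<le> m \<Longrightarrow> M m \<subseteq> M l"
    and X_inv_powi: "v \<in> M m \<Longrightarrow> fls_X_inv powi k *s v \<in> M (m - N * k)"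
    and exhaustive: "\<exists>m. v \<in> M m"
    and separated: "\<exists>m. poly_vectors \<inter> M m \<subseteq> {0}"
begin

section \<open>Depth in a filtration\<close>

lemma zero_mem: "0 \<in> M m"
  using subspace by (rule Omod.subspace_0)

lemma diff_mem: "v \<in> M m \<Longrightarrow> w \<in> M m \<Longrightarrow> v - w \<in> M m"
  using subspace by (rule Omod.subspace_diff)

lemma sum_mem: "(\<And>i. i \<in> A \<Longrightarrow> f i \<in> M m) \<Longrightarrow> sum f A \<in> M m"
  using subspace by (rule Omod.subspace_sum)

text \<open>A series of subdegree s is t^(-s) times a power series, so it shifts the index by N *
  s.\<close>

lemma scale_mem:
  assumes "v \<in> M m" "l \<le> m + N * fls_subdegree a"
  shows "a *s v \<in> M l"
proof -
  obtain u where "a = fls_X_inv powi (- fls_subdegree a) * fps_to_fls u"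
    using fls_split_X_inv_powi[of "fls_subdegree a" a] by blast
  then have "a *s v = fls_X_inv powi (- fls_subdegree a) *s (fps_to_fls u *s v)"
    by (simp add: vector_smult_assoc)
  also have "\<dots> \<in> M (m - N * (- fls_subdegree a))"
    using Omod.subspace_scale[OF subspace assms(1)] by (rule X_inv_powi)
  finally show ?thesis
    using antimono[OF assms(2)] by auto
qed

lemma scale_mem_iff:
  assumes "a \<noteq> 0"
  shows "a *s v \<in> M m \<longleftrightarrow> v \<in> M (m - N * fls_subdegree a)"
proof
  assume "a *s v \<in> M m"
  then have "inverse a *s (a *s v) \<in> M (m - N * fls_subdegree a)"
    by (rule scale_mem) (use assms in auto)
  then show "v \<in> M (m - N * fls_subdegree a)"
    using assms by (simp add: vector_smult_assoc)
next
  assume "v \<in> M (m - N * fls_subdegree a)"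
  then show "a *s v \<in> M m"
    by (rule scale_mem) simp
qed

text \<open>By \<open>separated\<close>, some step contains no polynomial vector except 0, which
  lies in \<open>W\<close>. So the depths of the polynomial vectors outside \<open>W\<close> are
  bounded above, and \<open>exhaustive\<close> provides at least one depth.\<close>

lemma maximal_vector:
  assumes "0 \<in> W" "\<not> poly_vectors \<subseteq> W"
  obtains b l where "b \<in> poly_vectors - W" "b \<in> M l"
    "\<And>w. w \<in> poly_vectors - W \<Longrightarrow> w \<notin> M (l + 1)"
proof -
  define K where "K = {m. (poly_vectors - W) \<inter> M m \<noteq> {}}"
  obtain J where J: "poly_vectors \<inter> M J \<subseteq> {0}"
    using separated by blast
  have bound: "m < J" if "m \<in> K" for m
    using that J antimono[of J m] assms(1) unfolding K_def by (force simp: not_le[symmetric])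
  obtain w m where "w \<in> poly_vectors - W" "w \<in> M m"
    using assms(2) exhaustive by blast
  then have "m \<in> K"
    unfolding K_def by blast
  then have ex: "J - int (nat (J - m)) \<in> K"
    using bound[of m] by simp
  \<comment> \<open>Minimizing the distance from the upper bound \<open>J\<close> turns the search
    for a largest integer in \<open>K\<close> into one for a least natural number.\<close>
  define n where "n = (LEAST n. J - int n \<in> K)"
  have "J - int n \<in> K"
    unfolding n_def by (rule LeastI[of "\<lambda>n. J - int n \<in> K", OF ex])
  moreover have "J - int n + 1 \<notin> K"
  proof
    assume K: "J - int n + 1 \<in> K"
    then have "0 < n"
      using bound by fastforce
    then have "J - int (n - 1) \<in> K"
      using K by (simp add: of_nat_diff algebra_simps)
    then have "n \<le> n - 1"
      unfolding n_def by (rule Least_le)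
    with \<open>0 < n\<close> show False by simp
  qed
  ultimately show thesis
    unfolding K_def using that by blast
qed

text \<open>The analogue of Minkowski's successive minima for F_q[t]^d, a deeper vector counting as
  a shorter one.\<close>

definition successive_maxima :: "('d \<Rightarrow> ('a fls, 'd) vec) \<Rightarrow> ('d \<Rightarrow> int) \<Rightarrow> bool" where
  "successive_maxima b l \<longleftrightarrow>
    (\<forall>k. b k \<in> poly_vectors - vec.span (b ` {..<k}) \<and> b k \<in> M (l k) \<and>
      (\<forall>w\<in>poly_vectors - vec.span (b ` {..<k}). w \<notin> M (l k + 1)))"

text \<open>Recursion along the finite linear order: fewer than d vectors are chosen before
  \<open>k\<close>, so their span is proper and misses a standard basis vector, which is polynomial.
  Hence \<open>maximal_vector\<close> applies.\<close>

lemma successive_maxima_exist: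
  obtains b l where "successive_maxima b l"
proof -
  define R where "R = {(j, k :: 'd). j < k}"
  define P where "P = (\<lambda>(f :: 'd \<Rightarrow> ('a fls, 'd) vec \<times> int) k (w, m).
    w \<in> poly_vectors - vec.span ((fst \<circ> f) ` {..<k}) \<and> w \<in> M m \<and>
      (\<forall>w\<in>poly_vectors - vec.span ((fst \<circ> f) ` {..<k}). w \<notin> M (m + 1)))"
  have "wf R"
    by (rule wf_subset[OF wf_measure[of "\<lambda>k :: 'd. card {..<k}"]])
      (auto simp: R_def intro!: psubset_card_mono)
  \<comment> \<open>Dependent choice requires the condition at \<open>k\<close> to depend on the
    earlier choices only.\<close>
  moreover have "P f k r = P g k r" if "\<And>j. (j, k) \<in> R \<Longrightarrow> f j = g j" for f g k r
  proof -
    have "(fst \<circ> f) ` {..<k} = (fst \<circ> g) ` {..<k}"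
      using that by (intro image_cong) (auto simp: R_def)
    then show ?thesis
      by (simp only: P_def)
  qed
  moreover have "\<exists>r. P f k r" for f k
  proof -
    let ?B = "(fst \<circ> f) ` {..<k}"
    have "card ?B \<le> card {..<k}"
      by (rule card_image_le) simp
    also have "\<dots> < CARD('d)"
      by (rule psubset_card_mono) auto
    finally have "vec.dim (vec.span ?B) < CARD('d)"
      using vec.dim_le_card'[of ?B] by (simp add: vec.dim_span)
    have "\<not> poly_vectors \<subseteq> vec.span ?B"
    proof
      assume "poly_vectors \<subseteq> vec.span ?B"
      then have "cart_basis \<subseteq> vec.span ?B"
        using poly_vectors_axis by (auto simp: cart_basis_def)
      then have "vec.span ?B = UNIV"
        using vec.span_minimal[of cart_basis "vec.span ?B"] vec.span_Basis by auto
      with \<open>vec.dim (vec.span ?B) < CARD('d)\<close> show False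
        by (simp only: vec_dim_card less_irrefl)
    qed
    then obtain w m where "w \<in> poly_vectors - vec.span ?B" "w \<in> M m"
        "\<And>w. w \<in> poly_vectors - vec.span ?B \<Longrightarrow> w \<notin> M (m + 1)"
      using maximal_vector[of "vec.span ?B"] vec.span_zero by blast
    then have "P f k (w, m)"
      unfolding P_def by blast
    then show ?thesis ..
  qed
  ultimately obtain f where f: "\<And>k. P f k (f k)"
    using dependent_wf_choice[of R P] by blast
  have "successive_maxima (fst \<circ> f) (snd \<circ> f)"
    unfolding successive_maxima_def
  proof (intro allI)
    fix k
    show "(fst \<circ> f) k \<in> poly_vectors - vec.span ((fst \<circ> f) ` {..<k}) \<and> (fst \<circ> f) k \<in> M ((snd \<circ> f) k) \<and>
      (\<forall>w\<in>poly_vectors - vec.span ((fst \<circ> f) ` {..<k}). w \<notin> M ((snd \<circ> f) k + 1))"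
      using f[of k] unfolding P_def by (cases "f k") auto
  qed
  then show thesis ..
qed

section \<open>Properties of successive maxima\<close>

context
  fixes b :: "'d \<Rightarrow> ('a fls, 'd) vec" and l :: "'d \<Rightarrow> int"
  assumes b: "successive_maxima b l"
begin

lemma b_notin_span: "b k \<notin> vec.span (b ` {..<k})"
  using b unfolding successive_maxima_def by blast

lemma b_poly: "b k \<in> poly_vectors"
  using b unfolding successive_maxima_def by blast

lemma b_mem: "b k \<in> M (l k)"
  using b unfolding successive_maxima_def by blast

lemma b_max: "w \<in> poly_vectors \<Longrightarrow> w \<in> M (l k + 1) \<Longrightarrow> w \<in> vec.span (b ` {..<k})"
  using b unfolding successive_maxima_def by blast

text \<open>At stage \<open>j\<close> the vector \<open>b k\<close> was already a candidate, as it
  lies outside the smaller span; a greater depth would contradict the choice of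
  \<open>b j\<close>.\<close>

lemma l_antimono: "antimono l"
proof (rule antimonoI, rule ccontr)
  fix j k assume "j \<le> k" "\<not> l k \<le> l j"
  then have "b k \<in> M (l j + 1)"
    using b_mem[of k] antimono[of "l j + 1" "l k"] by auto
  then have "b k \<in> vec.span (b ` {..<j})"
    using b_poly b_max by blast
  also have "\<dots> \<subseteq> vec.span (b ` {..<k})"
    using \<open>j \<le> k\<close> by (intro vec.span_mono) auto
  finally show False
    using b_notin_span by blast
qed

text \<open>The depth of \<open>b k\<close> is exactly \<open>l k\<close>, since \<open>b k\<close>
  is itself bound by the maximality at stage \<open>k\<close>. A nonzero factor \<open>a\<close>
  shifts it by N times its subdegree.\<close>

lemma scale_b_mem_iff: "a *s b k \<in> M m \<longleftrightarrow> a = 0 \<or> m \<le> l k + N * fls_subdegree a"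
proof (cases "a = 0")
  case False
  have "b k \<in> M n \<longleftrightarrow> n \<le> l k" for n
    using b_mem[of k] b_max[OF b_poly, of k k] b_notin_span[of k] antimono[of n "l k"]
      antimono[of "l k + 1" n] by force
  with False show ?thesis
    by (simp add: scale_mem_iff algebra_simps)
qed (simp add: zero_mem)

lemma b_independent: "(\<Sum>j\<in>UNIV. a j *s b j) = 0 \<Longrightarrow> a k = 0"
proof (rule ccontr)
  assume "(\<Sum>j\<in>UNIV. a j *s b j) = 0" "a k \<noteq> 0"
  moreover from \<open>a k \<noteq> 0\<close> obtain k' where "a k' \<noteq> 0" "\<And>j. k' < j \<Longrightarrow> a j = 0"
    using last_nonzero[of "\<lambda>j. a j \<noteq> 0"] by metis
  ultimately show False
    using sum_notin_span[of b k' a] b_notin_span vec.span_zero by metis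
qed

text \<open>Replacing the coefficients by their remainders changes the vector by a polynomial one.
  The new combination is again polynomial, but deeper than maximality at its last nonzero term
  allows, so the remainders vanish. Hence the \<open>b j\<close> generate F_q[t]^d over
  F_q[t].\<close>

lemma b_coeff_poly:
  assumes v: "(\<Sum>j\<in>UNIV. a j *s b j) \<in> poly_vectors"
  shows "a k \<in> range poly_to_fls"
proof -
  have "\<exists>p. \<forall>n\<le>0. fls_nth (poly_to_fls p) n = fls_nth (a j) n" for j
    using poly_part[of "a j"] by metis
  then obtain p where p: "\<And>j n. n \<le> 0 \<Longrightarrow> fls_nth (poly_to_fls (p j)) n = fls_nth (a j) n"
    by metis
  define r where "r j = a j - poly_to_fls (p j)" for j
  have sub: "1 \<le> fls_subdegree (r j)" if "r j \<noteq> 0" for j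
    using that by (rule fls_subdegree_geI) (simp add: r_def p)
  let ?w = "\<Sum>j\<in>UNIV. r j *s b j"
  have "?w = (\<Sum>j\<in>UNIV. a j *s b j) - (\<Sum>j\<in>UNIV. poly_to_fls (p j) *s b j)"
    by (simp add: r_def vector_sub_rdistrib sum_subtractf)
  then have w: "?w \<in> poly_vectors"
    using v b_poly by (auto intro!: poly_vectors_diff poly_vectors_sum poly_vectors_scale)
  have "r k = 0"
  proof (rule ccontr)
    assume "r k \<noteq> 0"
    then obtain k' where k': "r k' \<noteq> 0" "\<And>j. k' < j \<Longrightarrow> r j = 0"
      using last_nonzero[of "\<lambda>j. r j \<noteq> 0"] by metis
    have "r j *s b j \<in> M (l k' + 1)" for j
    proof (cases "r j = 0")
      case False
      \<comment> \<open>Past \<open>k'\<close> the remainders vanish, so \<open>j \<le> k'\<close>,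
        and \<open>l\<close> is decreasing. A subdegree of at least 1 then adds at least 1 to the
        depth.\<close>
      then have "l k' \<le> l j"
        using k'(2) antimonoD[OF l_antimono] by (meson not_le)
      moreover have "1 * 1 \<le> N * fls_subdegree (r j)"
        using sub[OF False] N_pos by (intro mult_mono) auto
      ultimately show ?thesis
        by (simp add: scale_b_mem_iff)
    qed (simp add: zero_mem)
    then have "?w \<in> M (l k' + 1)"
      by (rule sum_mem)
    then have "?w \<in> vec.span (b ` {..<k'})"
      using w b_max by blast
    then show False
      using sum_notin_span[of b k' r] b_notin_span k' by blast
  qed
  then show ?thesis
    by (simp add: r_def)
qed

text \<open>
  At the last term outside \<open>M m\<close>, scaled so that its coefficient becomes a unit, the polynomial parts
  of the coefficients would give a vector of \<^const>\<open>poly_vectors\<close> deeper in the filtration than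
  the maximum allows.
\<close>

lemma b_orthogonal:
  assumes v: "(\<Sum>j\<in>UNIV. a j *s b j) \<in> M m"
  shows "a k *s b k \<in> M m"
proof (rule ccontr)
  assume "a k *s b k \<notin> M m"
  then obtain k' where k': "a k' *s b k' \<notin> M m" "\<And>j. k' < j \<Longrightarrow> a j *s b j \<in> M m"
    using last_nonzero[of "\<lambda>j. a j *s b j \<notin> M m"] by metis
  have a: "a k' \<noteq> 0" and m: "l k' + N * fls_subdegree (a k') < m"
    using k'(1) by (auto simp: scale_b_mem_iff)
  \<comment> \<open>This power of t gives \<open>s * a k'\<close> subdegree 0, so that its
    polynomial part has a nonzero constant term.\<close>
  define s :: "'a fls" where "s = fls_X_inv powi fls_subdegree (a k')"
  have s: "s \<noteq> 0" "fls_subdegree s = - fls_subdegree (a k')"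
    by (simp_all add: s_def)
  have "\<exists>p. \<forall>n\<le>0. fls_nth (poly_to_fls p) n = fls_nth (s * a j) n" for j
    using poly_part[of "s * a j"] by metis
  then obtain p where p: "\<And>j n. n \<le> 0 \<Longrightarrow> fls_nth (poly_to_fls (p j)) n = fls_nth (s * a j) n"
    by metis
  \<comment> \<open>Terms beyond \<open>k'\<close> go entirely into the remainder \<open>r\<close>:
    they lie in \<open>M m\<close>, and multiplication by \<open>s\<close> moves \<open>M m\<close>
    into \<open>M (l k' + 1)\<close>.\<close>
  define c where "c j = (if j \<le> k' then poly_to_fls (p j) else 0)" for j
  define r where "r j = s * a j - c j" for j
  let ?w = "\<Sum>j\<in>UNIV. c j *s b j"
  have sv: "s *s (\<Sum>j\<in>UNIV. a j *s b j) \<in> M (l k' + 1)"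
    using v s m by (intro scale_mem[OF v]) simp
  have r: "r j *s b j \<in> M (l k' + 1)" for j
  proof (cases "j \<le> k'")
    case True
    have "1 \<le> fls_subdegree (r j)" if "r j \<noteq> 0"
      using that True by (intro fls_subdegree_geI) (simp_all add: r_def c_def p)
    moreover have "1 * 1 \<le> N * fls_subdegree (r j)" if "1 \<le> fls_subdegree (r j)"
      using that N_pos by (intro mult_mono) auto
    moreover have "l k' \<le> l j"
      using True antimonoD[OF l_antimono] by blast
    ultimately show ?thesis
      by (force simp: scale_b_mem_iff)
  next
    case False
    then have "a j *s b j \<in> M m"
      by (intro k'(2)) simp
    then have "s *s (a j *s b j) \<in> M (l k' + 1)"
      by (rule scale_mem) (use s m in simp)
    with False show ?thesis
      by (simp add: r_def c_def vector_smult_assoc)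
  qed
  have "?w = s *s (\<Sum>j\<in>UNIV. a j *s b j) - (\<Sum>j\<in>UNIV. r j *s b j)"
    by (simp add: r_def vector_sub_rdistrib sum_subtractf vec.scale_sum_right vector_smult_assoc)
  then have "?w \<in> M (l k' + 1)"
    using sv r by (auto intro!: diff_mem sum_mem)
  moreover have "?w \<in> poly_vectors"
    using b_poly poly_vectors_0 by (intro poly_vectors_sum) (auto simp: c_def intro: poly_vectors_scale)
  ultimately have "?w \<in> vec.span (b ` {..<k'})"
    using b_max by blast
  moreover have "fls_nth (c k') 0 \<noteq> 0"
  proof -
    have "fls_subdegree (s * a k') = 0" "s * a k' \<noteq> 0"
      using s a by auto
    then have "fls_nth (s * a k') 0 \<noteq> 0"
      by (metis nth_fls_subdegree_nonzero)
    then show ?thesis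
      by (simp add: c_def p)
  qed
  then have "c k' \<noteq> 0"
    by auto
  moreover have "c j = 0" if "k' < j" for j
    using that by (simp add: c_def)
  ultimately show False
    using sum_notin_span[of b k' c] b_notin_span by blast
qed

text \<open>In the basis \<open>b\<close> every step of the filtration is diagonal, so a single
  basis serves all steps at once.\<close>

lemma sum_b_mem_iff:
  "(\<Sum>j\<in>UNIV. a j *s b j) \<in> M m \<longleftrightarrow> (\<forall>j. a j = 0 \<or> m \<le> l j + N * fls_subdegree (a j))"
  using b_orthogonal[of a m] sum_mem[of UNIV "\<lambda>j. a j *s b j" m]
  by (auto simp: scale_b_mem_iff)

end

end

section \<open>Lattices\<close>

lemma module_hom_matrix:
  "module_hom (\<lambda>c (v :: 'a::field fls ^ 'd::finite). fps_to_fls c *s v)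
    (\<lambda>c (v :: 'a fls ^ 'd). fps_to_fls c *s v) ((*v) g)"
  by (intro module_hom.intro module_hom_axioms.intro Omod.module_axioms)
    (simp_all add: matrix_vector_right_distrib vector_scalar_commute)

lemma is_lattice_image:
  fixes g :: "'a::field fls ^ 'd::finite ^ 'd"
  assumes "invertible g" "is_lattice L"
  shows "is_lattice ((*v) g ` L)"
proof -
  obtain A where "finite A" "L = Omod.span A"
    using assms(2) unfolding is_lattice_def by blast
  then have "finite ((*v) g ` A)" "(*v) g ` L = Omod.span ((*v) g ` A)"
    using module_hom.span_image[OF module_hom_matrix, of g A] by simp_all
  moreover obtain h where "g ** h = mat 1"
    using assms(1) unfolding invertible_def by blast
  then have "(*v) g ` UNIV = UNIV"
    by (metis matrix_right_invertible_surjective)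
  then have "vec.span ((*v) g ` L) = UNIV"
    using assms(2) unfolding is_lattice_def
    by (simp add: vec.linear_span_image[OF matrix_vector_mul_linear_gen])
  ultimately show ?thesis
    unfolding is_lattice_def by blast
qed

lemma is_lattice_subspace: "is_lattice L \<Longrightarrow> Omod.subspace L"
  unfolding is_lattice_def using Omod.subspace_span by blast

lemma std_lattice_alt:
  "(std_lattice n :: ('a::field fls ^ 'd::finite) set) =
    {v. \<forall>i. \<exists>c. v $ i = fls_X_inv powi n i * fps_to_fls c}"
proof -
  have "(\<Sum>i\<in>UNIV. (fls_X_inv powi n i * fps_to_fls (c i)) *s axis i 1) $ k =
      fls_X_inv powi n k * fps_to_fls (c k)" for k :: 'd and c :: "'d \<Rightarrow> 'a fps"
    by (simp add: axis_def if_distrib cong: if_cong)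
  then have "(\<Sum>i\<in>UNIV. (fls_X_inv powi n i * fps_to_fls (c i)) *s axis i 1) =
      (\<chi> i. fls_X_inv powi n i * fps_to_fls (c i))" for c :: "'d \<Rightarrow> 'a fps"
    by (simp add: vec_eq_iff)
  then have "std_lattice n = {\<chi> i. fls_X_inv powi n i * fps_to_fls (c i) | c :: 'd \<Rightarrow> 'a fps. True}"
    unfolding std_lattice_def by simp
  also have "\<dots> = {v. \<forall>i. \<exists>c. v $ i = fls_X_inv powi n i * fps_to_fls c}"
    by (auto simp: vec_eq_iff choice_iff)
  finally show ?thesis .
qed

text \<open>Apart from 0, the elements of t^k O are the series of subdegree at least -k. The entry 0
  has its own disjunct since its subdegree is 0 by convention.\<close>

lemma mem_std_lattice_iff:
  fixes v :: "'a::field fls ^ 'd::finite"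
  shows "v \<in> std_lattice n \<longleftrightarrow> (\<forall>i. v $ i = 0 \<or> - n i \<le> fls_subdegree (v $ i))"
proof -
  have "(\<exists>c. a = fls_X_inv powi k * fps_to_fls c) \<longleftrightarrow> a = 0 \<or> - k \<le> fls_subdegree a"
    for a :: "'a fls" and k
  proof
    show "a = 0 \<or> - k \<le> fls_subdegree a" if "\<exists>c. a = fls_X_inv powi k * fps_to_fls c"
    proof -
      from that obtain c where "a = fls_X_inv powi k * fps_to_fls c" ..
      then show ?thesis
        using fls_subdegree_fls_to_fps_gt0[of c] by (cases "c = 0") auto
    qed
    show "\<exists>c. a = fls_X_inv powi k * fps_to_fls c" if "a = 0 \<or> - k \<le> fls_subdegree a"
      using fls_split_X_inv_powi[of "- k" a] that by auto
  qed
  then show ?thesis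
    by (simp add: std_lattice_alt)
qed

lemma subspace_std_lattice:
  "Omod.subspace (std_lattice n :: ('a::field fls ^ 'd::finite) set)"
proof (rule Omod.subspaceI)
  fix v w :: "'a fls ^ 'd" and c :: "'a fps"
  assume "v \<in> std_lattice n"
  then obtain e where e: "\<And>i. v $ i = fls_X_inv powi n i * fps_to_fls (e i)"
    unfolding std_lattice_alt by (auto simp: choice_iff)
  then have "(fps_to_fls c *s v) $ i = fls_X_inv powi n i * fps_to_fls (c * e i)" for i
    by (simp add: fls_times_fps_to_fls)
  then show "fps_to_fls c *s v \<in> std_lattice n"
    unfolding std_lattice_alt by blast
  assume "w \<in> std_lattice n"
  then obtain e' where "\<And>i. w $ i = fls_X_inv powi n i * fps_to_fls (e' i)"
    unfolding std_lattice_alt by (auto simp: choice_iff)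
  with e have "(v + w) $ i = fls_X_inv powi n i * fps_to_fls (e i + e' i)" for i
    by (simp add: distrib_left)
  then show "v + w \<in> std_lattice n"
    unfolding std_lattice_alt by blast
qed (simp add: mem_std_lattice_iff)

lemma is_lattice_std_lattice:
  "is_lattice (std_lattice n :: ('a::field fls ^ 'd::finite) set)"
proof -
  let ?A = "(\<lambda>i. fls_X_inv powi n i *s axis i 1) ` UNIV :: ('a fls ^ 'd) set"
  have A: "?A \<subseteq> std_lattice n"
    by (auto simp: mem_std_lattice_iff axis_def)
  have "std_lattice n = Omod.span ?A"
  proof
    show "Omod.span ?A \<subseteq> std_lattice n"
      using A subspace_std_lattice by (rule Omod.span_minimal)
    show "std_lattice n \<subseteq> Omod.span ?A"
    proof
      fix v :: "'a fls ^ 'd" assume "v \<in> std_lattice n"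
      then obtain c where "v = (\<Sum>i\<in>UNIV. (fls_X_inv powi n i * fps_to_fls (c i)) *s axis i 1)"
        unfolding std_lattice_def by blast
      also have "\<dots> = (\<Sum>i\<in>UNIV. fps_to_fls (c i) *s (fls_X_inv powi n i *s axis i 1))"
        by (simp add: vector_smult_assoc mult.commute)
      also have "\<dots> \<in> Omod.span ?A"
        by (intro Omod.span_sum Omod.span_scale Omod.span_base) auto
      finally show "v \<in> Omod.span ?A" .
    qed
  qed
  moreover have "vec.span (std_lattice n :: ('a fls ^ 'd) set) = UNIV"
  proof -
    have "axis i 1 \<in> vec.span (std_lattice n :: ('a fls ^ 'd) set)" for i
    proof -
      have "fls_X_inv powi (- n i) *s (fls_X_inv powi n i *s axis i 1)
          \<in> vec.span (std_lattice n :: ('a fls ^ 'd) set)"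
        using A by (intro vec.span_scale vec.span_base) auto
      then show ?thesis
        by (simp add: vector_smult_assoc power_int_minus)
    qed
    then have "cart_basis \<subseteq> vec.span (std_lattice n :: ('a fls ^ 'd) set)"
      by (auto simp: cart_basis_def)
    then have "vec.span cart_basis \<subseteq> vec.span (std_lattice n :: ('a fls ^ 'd) set)"
      by (rule vec.span_minimal) (rule vec.subspace_span)
    then show ?thesis
      by (simp add: vec.span_Basis top.extremum_unique)
  qed
  ultimately show ?thesis
    unfolding is_lattice_def by (intro conjI exI[of _ ?A]) auto
qed

text \<open>Finitely many generators have bounded pole orders, and a bound for them holds for all
  integral combinations. The sum of all absolute orders serves as the bound.\<close>

lemma is_lattice_bounded:
  assumes "is_lattice (L :: ('a::field fls ^ 'd::finite) set)"
  obtains J where "L \<subseteq> std_lattice (\<lambda>_. J)"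
proof -
  obtain A where A: "finite A" "L = Omod.span A"
    using assms unfolding is_lattice_def by blast
  define J where "J = (\<Sum>v\<in>A. \<Sum>i\<in>UNIV. \<bar>fls_subdegree (v $ i)\<bar>)"
  have "\<bar>fls_subdegree (v $ i)\<bar> \<le> J" if "v \<in> A" for v :: "'a fls ^ 'd" and i
  proof -
    have "\<bar>fls_subdegree (v $ i)\<bar> \<le> (\<Sum>i\<in>UNIV. \<bar>fls_subdegree (v $ i)\<bar>)"
      by (intro member_le_sum) auto
    also have "\<dots> \<le> J"
      unfolding J_def using A(1) that
      by (intro member_le_sum[of v A "\<lambda>v :: 'a fls ^ 'd. \<Sum>i\<in>UNIV. \<bar>fls_subdegree (v $ i)\<bar>"]) (auto intro: sum_nonneg)
    finally show ?thesis .
  qed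
  then have "A \<subseteq> std_lattice (\<lambda>_. J)"
    by (intro subsetI) (simp add: mem_std_lattice_iff, smt (verit))
  then have "L \<subseteq> std_lattice (\<lambda>_. J)"
    using A(2) Omod.span_minimal subspace_std_lattice by blast
  then show thesis ..
qed

text \<open>The vectors that some power of t carries into \<open>L\<close> form an F-subspace. It
  contains \<open>L\<close>, which spans F^d, so it is everything.\<close>

lemma is_lattice_absorbing:
  assumes "is_lattice (L :: ('a::field fls ^ 'd::finite) set)"
  obtains k where "fls_X_inv powi k *s v \<in> L"
proof -
  have L: "Omod.subspace L"
    using assms by (rule is_lattice_subspace)
  \<comment> \<open>Smaller exponents also work, as t^(l - k) is integral for
    \<open>l \<le> k\<close>. For a sum of two vectors this permits the minimum of their
    exponents.\<close>
  have down: "fls_X_inv powi l *s v \<in> L" if "fls_X_inv powi k *s v \<in> L" "l \<le> k" for k l :: int and v :: "'a fls ^ 'd"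
  proof -
    have "fls_X_inv powi (l - k) \<in> {f :: 'a fls. 0 \<le> fls_subdegree f}"
      using that(2) by simp
    then obtain u where u: "(fls_X_inv powi (l - k) :: 'a fls) = fps_to_fls u"
      unfolding range_fps_to_fls[symmetric] by blast
    have "fls_X_inv powi (l - k) *s (fls_X_inv powi k *s v) \<in> L"
      unfolding u using L that(1) by (rule Omod.subspace_scale)
    then show ?thesis
      by (simp add: vector_smult_assoc flip: power_int_add)
  qed
  have "vec.subspace {v. \<exists>k. fls_X_inv powi k *s v \<in> L}"
  proof (rule vec.subspaceI)
    show "0 \<in> {v. \<exists>k. fls_X_inv powi k *s v \<in> L}"
      using Omod.subspace_0[OF L] by simp
  next
    fix v w :: "'a fls ^ 'd"
    assume "v \<in> {v. \<exists>k. fls_X_inv powi k *s v \<in> L}" "w \<in> {v. \<exists>k. fls_X_inv powi k *s v \<in> L}"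
    then obtain k l where "fls_X_inv powi k *s v \<in> L" "fls_X_inv powi l *s w \<in> L"
      by blast
    then have "fls_X_inv powi (min k l) *s v + fls_X_inv powi (min k l) *s w \<in> L"
      using down by (intro Omod.subspace_add[OF L]) (meson min.cobounded1 min.cobounded2)+
    then show "v + w \<in> {v. \<exists>k. fls_X_inv powi k *s v \<in> L}"
      by (auto simp: vector_add_ldistrib)
  next
    fix v :: "'a fls ^ 'd" and a :: "'a fls"
    assume "v \<in> {v. \<exists>k. fls_X_inv powi k *s v \<in> L}"
    then obtain k where k: "fls_X_inv powi k *s v \<in> L"
      by blast
    obtain u where u: "a = fls_X_inv powi (- fls_subdegree a) * fps_to_fls u"
      using fls_split_X_inv_powi[of "fls_subdegree a" a] by blast
    have "fls_X_inv powi (k + fls_subdegree a) *s (a *s v) = fps_to_fls u *s (fls_X_inv powi k *s v)"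
      by (subst (2) u) (simp add: vector_smult_assoc power_int_add power_int_minus)
    also have "\<dots> \<in> L"
      using L k by (rule Omod.subspace_scale)
    finally show "a *s v \<in> {v. \<exists>k. fls_X_inv powi k *s v \<in> L}"
      by blast
  qed
  moreover have "L \<subseteq> {v. \<exists>k. fls_X_inv powi k *s v \<in> L}"
    by (auto intro: exI[of _ 0])
  ultimately have "vec.span L \<subseteq> {v. \<exists>k. fls_X_inv powi k *s v \<in> L}"
    by (intro vec.span_minimal)
  then show thesis
    using assms that unfolding is_lattice_def by blast
qed

text \<open>The step with index q * N + r, where 0 \<le> r < N, is t^(-q) times \<open>L r\<close>.
  Thus \<open>L 0\<close>, ..., \<open>L i\<close> are the steps 0, ..., i, and step N is (1/t)
  \<open>L 0\<close>.\<close>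

lemma lattice_chain_filtration:
  fixes L :: "nat \<Rightarrow> ('a::field fls ^ 'd::{finite,linorder}) set"
  assumes lattice: "\<And>k. k \<le> i \<Longrightarrow> is_lattice (L k)"
    and chain: "\<And>k. k < i \<Longrightarrow> L (Suc k) \<subseteq> L k"
    and last: "scale_lattice (1 / fls_X_inv) (L 0) \<subseteq> L i"
  defines "N \<equiv> int i + 1"
  shows "lattice_filtration (\<lambda>m. {v. fls_X_inv powi (m div N) *s v \<in> L (nat (m mod N))}) N"
proof -
  define M where "M m = {v. fls_X_inv powi (m div N) *s v \<in> L (nat (m mod N))}" for m
  have N: "0 < N"
    by (simp add: N_def)
  have mod: "nat (m mod N) \<le> i" for m
    using pos_mod_bound[OF N, of m] by (simp add: N_def)
  have "lattice_filtration M N"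
  proof
    show "0 < N" by (fact N)
    show "Omod.subspace (M m)" for m
    proof (rule Omod.subspaceI)
      note L = is_lattice_subspace[OF lattice[OF mod[of m]]]
      show "0 \<in> M m"
        using Omod.subspace_0[OF L] by (simp add: M_def)
      show "v + w \<in> M m" if "v \<in> M m" "w \<in> M m" for v w
        using Omod.subspace_add[OF L] that by (simp add: M_def vector_add_ldistrib)
      show "fps_to_fls c *s v \<in> M m" if "v \<in> M m" for c v
        using Omod.subspace_scale[OF L, of _ c] that
        by (simp add: M_def) (metis vector_smult_assoc mult.commute)
    qed
    have step: "M (m + 1) \<subseteq> M m" for m
    \<comment> \<open>Inside a period the inclusion is \<open>chain\<close>; at its end, from
      \<open>L i\<close> to the next multiple of \<open>L 0\<close>, it is
      \<open>last\<close>.\<close>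
    proof (cases "m mod N = int i")
      case True
      have m: "m = N * (m div N) + int i"
        using True by (metis mult_div_mod_eq)
      then have "m + 1 = N * (m div N + 1)"
        by (simp add: N_def algebra_simps)
      then have "(m + 1) div N = m div N + 1" "(m + 1) mod N = 0"
        using N by simp_all
      moreover have "fls_X_inv powi q *s v \<in> L i" if "fls_X_inv powi (q + 1) *s v \<in> L 0" for q v
      proof -
        have "(1 / fls_X_inv) *s (fls_X_inv powi (q + 1) *s v) \<in> L i"
          using last that unfolding scale_lattice_def by blast
        then show ?thesis
          by (simp add: vector_smult_assoc power_int_add del: fls_divide_X_inv)
      qed
      ultimately show ?thesis
        using True by (auto simp: M_def)
    next
      case False
      have m: "m + 1 = N * (m div N) + (m mod N + 1)"
        by simp
      have "0 \<le> m mod N" "m mod N < int i"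
        using False mod[of m] pos_mod_sign[OF N, of m] by linarith+
      then have "(m + 1) div N = m div N" "(m + 1) mod N = m mod N + 1"
        using int_div_pos_eq[OF m] int_mod_pos_eq[OF m] by (simp_all add: N_def)
      moreover have "nat (m mod N + 1) = Suc (nat (m mod N))" "nat (m mod N) < i"
        using \<open>0 \<le> m mod N\<close> \<open>m mod N < int i\<close> by auto
      ultimately show ?thesis
        using chain by (auto simp: M_def)
    qed
    show "M m \<subseteq> M l" if "l \<le> m" for l m
      using that by (induction m rule: int_ge_induct) (use step in blast)+
    show "fls_X_inv powi k *s v \<in> M (m - N * k)" if "v \<in> M m" for v m k
    proof -
      have "m - N * k = m + N * (- k)" by simp
      then have "(m - N * k) div N = m div N - k" "(m - N * k) mod N = m mod N"
        using N by (simp_all only: div_mult_self2 mod_mult_self2)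
      with that show ?thesis
        by (simp add: M_def vector_smult_assoc flip: power_int_add)
    qed
    show "\<exists>m. v \<in> M m" for v
    proof -
      obtain k where "fls_X_inv powi k *s v \<in> L 0"
        using is_lattice_absorbing lattice by blast
      then have "v \<in> M (N * k)"
        using N by (simp add: M_def)
      then show ?thesis ..
    qed
    show "\<exists>m. poly_vectors \<inter> M m \<subseteq> {0}"
    proof -
      obtain J where J: "L 0 \<subseteq> std_lattice (\<lambda>_. J)"
        using is_lattice_bounded lattice by blast
      \<comment> \<open>At this depth t^(J+1) v lies in t^J O^d, so a nonzero entry of
        \<open>v\<close> would have subdegree at least 1, which is impossible for a
        polynomial.\<close>
      have "v = 0" if "v \<in> poly_vectors" "v \<in> M (N * (J + 1))" for v
      proof -
        have "fls_X_inv powi (J + 1) *s v \<in> std_lattice (\<lambda>_. J)"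
          using that(2) J N by (auto simp: M_def)
        then have "v $ j = 0 \<or> - J \<le> fls_subdegree (fls_X_inv powi (J + 1) * v $ j)" for j
          by (force simp: mem_std_lattice_iff)
        moreover have "fls_subdegree (v $ j) \<le> 0" for j
        proof -
          have "v $ j \<in> range poly_to_fls"
            using that(1) by (simp add: poly_vectors_def)
          then show ?thesis
            by (auto simp: fls_subdegree_poly_to_fls)
        qed
        moreover have "fls_subdegree (fls_X_inv powi (J + 1) * v $ j) = fls_subdegree (v $ j) - (J + 1)"
          if "v $ j \<noteq> 0" for j
          using that by simp
        ultimately have "v $ j = 0" for j
          by (smt (verit))
        then show ?thesis
          by (simp add: vec_eq_iff)
      qed
      then show ?thesis by blast
    qed
  qed
  then show ?thesis
    by (simp add: M_def[abs_def])
qed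

section \<open>Standard forms\<close>

definition poly_matrix :: "'a::field poly ^ 'd ^ 'd \<Rightarrow> 'a fls ^ 'd ^ 'd::finite" where
  "poly_matrix G = (\<chi> i j. poly_to_fls (G $ i $ j))"

lemma poly_matrix_mult: "poly_matrix (G ** H) = poly_matrix G ** poly_matrix H"
  by (simp add: poly_matrix_def matrix_matrix_mult_def vec_eq_iff poly_to_fls_sum)

lemma poly_matrix_one: "poly_matrix (mat 1) = mat 1"
  by (simp add: poly_matrix_def mat_def vec_eq_iff)

lemma poly_matrix_eq_iff: "poly_matrix G = poly_matrix H \<longleftrightarrow> G = H"
  by (simp add: poly_matrix_def vec_eq_iff)

lemma matrix_vector_mult_axis: "A *v axis k (1 :: 'a::comm_semiring_1) = column k A"
  by (simp add: matrix_vector_mult_def axis_def column_def if_distrib cong: if_cong)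

text \<open>Floor division by N is adjoint to multiplication by N. This converts depth inequalities
  into bounds on exponents of t.\<close>

lemma le_div_int_iff:
  fixes q x N :: int
  assumes "0 < N"
  shows "q \<le> x div N \<longleftrightarrow> N * q \<le> x"
proof
  assume "q \<le> x div N"
  then have "N * q \<le> N * (x div N)"
    using assms by (intro mult_left_mono) auto
  also have "\<dots> = x - x mod N"
    by (simp add: minus_mod_eq_mult_div)
  also have "\<dots> \<le> x"
    using pos_mod_sign[OF assms] by simp
  finally show "N * q \<le> x" .
next
  assume "N * q \<le> x"
  then have "N * q div N \<le> x div N"
    using assms by (rule zdiv_mono1)
  then show "q \<le> x div N"
    using assms by simp
qed

text \<open>The columns of \<open>G\<close> are successive maxima. Independence makes it invertible
  over F, and \<open>b_coeff_poly\<close> makes the inverse polynomial. The exponents arise by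
  solving the inequality of \<open>sum_b_mem_iff\<close> for the subdegree.\<close>

lemma (in lattice_filtration) standard_form:
  obtains G :: "(('a poly, 'd) vec, 'd) vec" and l :: "'d \<Rightarrow> int"
  where "invertible G" "antimono l"
    "\<And>m. M m = (*v) (poly_matrix G) ` std_lattice (\<lambda>j. (l j - m) div N)"
proof -
  obtain b l where b: "successive_maxima b l"
    using successive_maxima_exist by blast
  define G :: "(('a poly, 'd) vec, 'd) vec" where "G = (\<chi> i j. inv poly_to_fls (b j $ i))"
  have G: "poly_matrix G $ i $ j = b j $ i" for i j
    using b_poly[OF b, of j] by (simp add: poly_matrix_def G_def f_inv_into_f poly_vectors_def)
  have mult: "poly_matrix G *v x = (\<Sum>j\<in>UNIV. x $ j *s b j)" for x
    by (simp add: vec_eq_iff matrix_vector_mult_def G mult.commute)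
  have "\<exists>C. C ** poly_matrix G = mat 1"
    unfolding matrix_left_invertible_ker
  proof (intro allI impI)
    fix x assume "poly_matrix G *v x = 0"
    then show "x = 0"
      using b_independent[OF b, of "\<lambda>j. x $ j"] unfolding mult by (metis vec_eq_iff zero_index)
  qed
  then obtain C where C1: "C ** poly_matrix G = mat 1" ..
  then have C2: "poly_matrix G ** C = mat 1"
    by (rule matrix_left_right_inverse[THEN iffD1])
  note C = C1 C2
  \<comment> \<open>Column \<open>i\<close> of \<open>C\<close> holds the coordinates of a standard
    basis vector in the basis \<open>b\<close>, and that vector is polynomial.\<close>
  have range: "C $ j $ i \<in> range poly_to_fls" for i j
  proof -
    have "poly_matrix G *v (C *v axis i 1) = axis i 1"
      by (simp add: matrix_vector_mul_assoc C)
    then have "(\<Sum>j\<in>UNIV. (C *v axis i 1) $ j *s b j) \<in> poly_vectors"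
      using poly_vectors_axis by (simp flip: mult)
    then have "(C *v axis i 1) $ j \<in> range poly_to_fls"
      by (rule b_coeff_poly[OF b])
    then show ?thesis
      by (auto simp: matrix_vector_mult_axis column_def)
  qed
  define H :: "(('a poly, 'd) vec, 'd) vec" where "H = (\<chi> i j. inv poly_to_fls (C $ i $ j))"
  have "poly_matrix H = C"
    by (simp add: poly_matrix_def H_def vec_eq_iff f_inv_into_f[OF range])
  then have "G ** H = mat 1" "H ** G = mat 1"
    using C by (simp_all add: poly_matrix_mult poly_matrix_one flip: poly_matrix_eq_iff)
  then have "invertible G"
    unfolding invertible_def by blast
  moreover have "M m = (*v) (poly_matrix G) ` std_lattice (\<lambda>j. (l j - m) div N)" for m
  proof -
    have mem: "poly_matrix G *v x \<in> M m \<longleftrightarrow> x \<in> std_lattice (\<lambda>j. (l j - m) div N)" for x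
    proof -
      have "m \<le> l j + N * fls_subdegree (x $ j) \<longleftrightarrow> - ((l j - m) div N) \<le> fls_subdegree (x $ j)" for j
        using le_div_int_iff[OF N_pos, of "- fls_subdegree (x $ j)" "l j - m"] by auto
      then show ?thesis
        unfolding mult sum_b_mem_iff[OF b] mem_std_lattice_iff by simp
    qed
    show ?thesis
    proof (intro set_eqI iffI)
      fix v assume "v \<in> M m"
      moreover have v: "v = poly_matrix G *v (C *v v)"
        by (simp add: matrix_vector_mul_assoc C)
      ultimately have "C *v v \<in> std_lattice (\<lambda>j. (l j - m) div N)"
        using mem by metis
      with v show "v \<in> (*v) (poly_matrix G) ` std_lattice (\<lambda>j. (l j - m) div N)"
        by blast
    qed (use mem in auto)
  qed
  ultimately show thesis
    using l_antimono[OF b] that by blast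
qed

text \<open>All lattices of the chain are steps of one filtration, so one matrix serves them all.
  The exponents decrease since \<open>l\<close> does and floor division is monotone.\<close>

lemma lattice_chain_standard_form:
  fixes L :: "nat \<Rightarrow> ('a::field fls ^ 'd::{finite,linorder}) set"
  assumes "\<And>k. k \<le> i \<Longrightarrow> is_lattice (L k)"
    and "\<And>k. k < i \<Longrightarrow> L (Suc k) \<subseteq> L k"
    and "scale_lattice (1 / fls_X_inv) (L 0) \<subseteq> L i"
  obtains G :: "(('a poly, 'd) vec, 'd) vec" and n
  where "invertible G" "\<And>k. antimono (n k)"
    "\<And>k. k \<le> i \<Longrightarrow> L k = (*v) (poly_matrix G) ` std_lattice (n k)"
proof -
  define M where "M m = {v. fls_X_inv powi (m div (int i + 1)) *s v \<in> L (nat (m mod (int i + 1)))}" for m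
  interpret lattice_filtration M "int i + 1"
    using lattice_chain_filtration[of i L, OF assms] by (simp add: M_def[abs_def])
  obtain G :: "(('a poly, 'd) vec, 'd) vec" and l :: "'d \<Rightarrow> int" where G: "invertible G" "antimono l"
    "\<And>m. M m = (*v) (poly_matrix G) ` std_lattice (\<lambda>j. (l j - m) div (int i + 1))"
    using standard_form by metis
  have "antimono (\<lambda>j. (l j - int k) div (int i + 1))" for k
    using G(2) by (auto simp: antimono_def intro!: zdiv_mono1)
  moreover have "M (int k) = L k" if "k \<le> i" for k
    using that by (simp add: M_def)
  ultimately show thesis
    using G that[of G "\<lambda>k j. (l j - int k) div (int i + 1)"] by metis
qed

section \<open>Scaling and uniqueness of standard lattices\<close>

lemma scale_std_lattice:
  fixes n :: "'d::finite \<Rightarrow> int" and a :: "'a::field fls"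
  assumes "a \<noteq> 0"
  shows "scale_lattice a (std_lattice n) = (std_lattice (\<lambda>j. n j - fls_subdegree a) :: ('a fls ^ 'd) set)"
proof (intro set_eqI iffI)
  fix v :: "'a fls ^ 'd"
  assume "v \<in> scale_lattice a (std_lattice n)"
  then obtain w where w: "w \<in> std_lattice n" "v = a *s w"
    unfolding scale_lattice_def by blast
  have "v $ j = 0 \<or> - (n j - fls_subdegree a) \<le> fls_subdegree (v $ j)" for j
    using w assms by (cases "w $ j = 0") (auto simp: mem_std_lattice_iff)
  then show "v \<in> std_lattice (\<lambda>j. n j - fls_subdegree a)"
    by (simp add: mem_std_lattice_iff)
next
  fix v :: "'a fls ^ 'd"
  assume v: "v \<in> std_lattice (\<lambda>j. n j - fls_subdegree a)"
  have "(inverse a *s v) $ j = 0 \<or> - n j \<le> fls_subdegree ((inverse a *s v) $ j)" for j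
  proof (cases "v $ j = 0")
    case False
    then have "- (n j - fls_subdegree a) \<le> fls_subdegree (v $ j)"
      using v by (auto simp: mem_std_lattice_iff)
    with False assms show ?thesis
      by simp
  qed simp
  then have "inverse a *s v \<in> std_lattice n"
    unfolding mem_std_lattice_iff by blast
  moreover have "v = a *s (inverse a *s v)"
    using assms by (simp add: vector_smult_assoc)
  ultimately show "v \<in> scale_lattice a (std_lattice n)"
    unfolding scale_lattice_def by blast
qed

lemma lattice_class_scale:
  assumes "a \<noteq> 0"
  shows "lattice_class (scale_lattice a L) = lattice_class L"
proof -
  have *: "scale_lattice c (scale_lattice a L) = scale_lattice (c * a) L" for c
    by (simp add: scale_lattice_def image_image vector_smult_assoc)
  have "\<exists>c'. scale_lattice c L = scale_lattice (c' * a) L \<and> c' \<noteq> 0" if "c \<noteq> 0" for c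
    using that assms by (intro exI[of _ "c / a"]) simp
  then show ?thesis
    unfolding lattice_class_def * using assms by auto
qed

text \<open>Dividing by t to the power of the last exponent makes that exponent 0 and keeps the
  class.\<close>

lemma lattice_class_std_lattice:
  assumes "antimono n"
  shows "lattice_class (std_lattice n :: ('a::field fls ^ 'd::{finite,linorder}) set) \<in> std_vertices"
proof -
  define n' where "n' j = n j - n (Max UNIV)" for j
  define a :: "'a fls" where "a = fls_X_inv powi (- n (Max UNIV))"
  have a: "a \<noteq> 0" "fls_subdegree a = n (Max UNIV)"
    by (simp_all add: a_def)
  have "scale_lattice a (std_lattice n) = (std_lattice n' :: ('a fls, 'd) vec set)"
    using a by (simp add: scale_std_lattice n'_def[abs_def])
  then have "lattice_class (std_lattice n' :: ('a fls, 'd) vec set) = lattice_class (std_lattice n)"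
    using lattice_class_scale[OF a(1)] by metis
  moreover have "antimono n'" "n' (Max UNIV) = 0"
    using assms by (auto simp: n'_def antimono_def)
  ultimately show ?thesis
    unfolding std_vertices_def by blast
qed

text \<open>
  A nonzero entry \<open>g\<^sub>i\<^sub>j\<close> has nonpositive order at infinity, so \<open>n\<^sub>j \<le> m\<^sub>i\<close>. The determinant of \<open>g\<close>
  has a nonvanishing term, and its permutation sends some \<open>i \<ge> k\<close> to some \<open>j \<le> k\<close>.
\<close>

lemma std_lattice_image_le:
  fixes n m :: "'d::{finite,linorder} \<Rightarrow> int" and G :: "(('a::field poly, 'd) vec, 'd) vec"
  assumes inv: "invertible (poly_matrix G)"
    and sub: "(*v) (poly_matrix G) ` std_lattice n \<subseteq> std_lattice m"
    and anti: "antimono n" "antimono m"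
  shows "n k \<le> m k"
proof -
  have entry: "n j \<le> m i" if "poly_matrix G $ i $ j \<noteq> 0" for i j
  proof -
    have "(fls_X_inv powi n j *s axis j 1 :: ('a fls, 'd) vec) \<in> std_lattice n"
      by (auto simp: mem_std_lattice_iff axis_def)
    then have "poly_matrix G *v (fls_X_inv powi n j *s axis j 1) \<in> std_lattice m"
      using sub by blast
    moreover have "poly_matrix G *v (fls_X_inv powi n j *s axis j 1) =
        fls_X_inv powi n j *s column j (poly_matrix G)"
      by (simp add: vector_scalar_commute matrix_vector_mult_axis)
    ultimately have "- m i \<le> fls_subdegree (fls_X_inv powi n j * poly_matrix G $ i $ j)"
      using that by (auto simp: mem_std_lattice_iff column_def)
    moreover have "fls_subdegree (poly_matrix G $ i $ j) \<le> 0"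
      by (simp add: poly_matrix_def fls_subdegree_poly_to_fls)
    ultimately show ?thesis
      using that by simp
  qed
  have "det (poly_matrix G) \<noteq> 0"
    using inv by (simp add: invertible_det_nz)
  then obtain \<pi> where \<pi>: "\<pi> permutes UNIV" "(\<Prod>i\<in>UNIV. poly_matrix G $ i $ \<pi> i) \<noteq> 0"
    unfolding det_def by (rule sum.not_neutral_contains_not_neutral) auto
  then have nz: "poly_matrix G $ i $ \<pi> i \<noteq> 0" for i
    by auto
  \<comment> \<open>Pigeonhole: the preimage of \<open>{..k}\<close> under the permutation is too
    large to fit into \<open>{..<k}\<close>.\<close>
  have "\<exists>i\<ge>k. \<pi> i \<le> k"
  proof (rule ccontr)
    assume "\<not> (\<exists>i\<ge>k. \<pi> i \<le> k)"
    then have "{i. \<pi> i \<le> k} \<subseteq> {..<k}"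
      by (auto simp: not_le[symmetric])
    then have "card {i. \<pi> i \<le> k} \<le> card {..<k}"
      by (intro card_mono) auto
    also have "\<dots> < card {..k}"
      by (intro psubset_card_mono) auto
    also have "{..k} = \<pi> ` {i. \<pi> i \<le> k}"
      using permutes_surj[OF \<pi>(1)] by (auto simp: surj_def image_iff)
    also have "card \<dots> \<le> card {i. \<pi> i \<le> k}"
      by (rule card_image_le) simp
    finally show False by simp
  qed
  then obtain i where "k \<le> i" "\<pi> i \<le> k"
    by blast
  then have "n k \<le> n (\<pi> i)" "m i \<le> m k"
    using anti by (auto dest: antimonoD)
  with entry[OF nz, of i] show ?thesis
    by simp
qed

lemma invertible_poly_matrix:
  assumes "invertible G"
  shows "invertible (poly_matrix G)"
  using assms unfolding invertible_def by (metis poly_matrix_mult poly_matrix_one)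

text \<open>\<open>G\<close> maps one standard lattice to a multiple of the other, which is standard
  with shifted exponents. The inequalities for \<open>G\<close> and its inverse give equality up to
  this shift, and the last exponents force the shift to be 0.\<close>

lemma std_lattice_class_unique:
  fixes n m :: "'d::{finite,linorder} \<Rightarrow> int" and G :: "(('a::field poly, 'd) vec, 'd) vec"
  assumes G: "invertible G"
    and eq: "lattice_class ((*v) (poly_matrix G) ` std_lattice n) = lattice_class (std_lattice m)"
    and n: "antimono n" "n (Max UNIV) = 0"
    and m: "antimono m" "m (Max UNIV) = 0"
  shows "n = m"
proof -
  obtain H where H: "G ** H = mat 1" "H ** G = mat 1"
    using G unfolding invertible_def by blast
  have "scale_lattice 1 ((*v) (poly_matrix G) ` std_lattice n)
      \<in> lattice_class ((*v) (poly_matrix G) ` std_lattice n)"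
    unfolding lattice_class_def by (intro CollectI exI[of _ 1]) simp
  then have "scale_lattice 1 ((*v) (poly_matrix G) ` std_lattice n) \<in> lattice_class (std_lattice m)"
    by (simp only: eq)
  then obtain a where a: "a \<noteq> 0" "(*v) (poly_matrix G) ` std_lattice n = scale_lattice a (std_lattice m)"
    by (auto simp: lattice_class_def scale_lattice_def)
  define m' where "m' j = m j - fls_subdegree a" for j
  have m': "antimono m'"
    using m(1) by (auto simp: m'_def antimono_def)
  have img: "(*v) (poly_matrix G) ` std_lattice n = std_lattice m'"
    using a by (simp add: scale_std_lattice m'_def[abs_def])
  have "(*v) (poly_matrix H) ` std_lattice m' = (*v) (poly_matrix H ** poly_matrix G) ` std_lattice n"
    unfolding img[symmetric] by (simp add: image_image matrix_vector_mul_assoc)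
  then have img': "(*v) (poly_matrix H) ` std_lattice m' = std_lattice n"
    by (simp add: H poly_matrix_one flip: poly_matrix_mult)
  have "n k \<le> m' k" for k
    using img by (intro std_lattice_image_le[of G] invertible_poly_matrix n m' G) simp
  moreover have "m' k \<le> n k" for k
    using img' H by (intro std_lattice_image_le[of H] invertible_poly_matrix n m')
      (auto simp: invertible_def)
  ultimately have eq: "n k = m' k" for k
    by (simp add: antisym)
  then have "fls_subdegree a = 0"
    using n(2) m(2) by (simp add: m'_def)
  with eq show ?thesis
    by (auto simp: m'_def)
qed

section \<open>The action on the building\<close>

lemma act_pgl_class_cancel:
  assumes "h ** g = mat 1"
  shows "act (pgl_class h) (act (pgl_class g) (lattice_class L)) = lattice_class L"
  by (simp add: act_class image_image matrix_vector_mul_assoc assms)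

lemma inj_on_act:
  assumes "invertible g"
  shows "inj_on (act (pgl_class g)) vertices"
proof -
  obtain h where "h ** g = mat 1"
    using assms unfolding invertible_def by blast
  then show ?thesis
    by (intro inj_on_inverseI[of _ "act (pgl_class h)"])
      (auto simp: vertices_def act_pgl_class_cancel)
qed

lemma simplices_subset_vertices: "S \<in> simplices \<Longrightarrow> S \<subseteq> vertices"
  unfolding simplices_def vertices_def by auto

lemma scale_lattice_image: "scale_lattice a ((*v) g ` L) = (*v) g ` scale_lattice a L"
  by (simp add: scale_lattice_def image_image vector_scalar_commute)

lemma act_simplex:
  assumes g: "invertible g" and S: "S \<in> simplices"
  shows "act (pgl_class g) ` S \<in> simplices"
proof -
  obtain i L where L: "S = (\<lambda>k. lattice_class (L k)) ` {..i}" "\<And>k. k \<le> i \<Longrightarrow> is_lattice (L k)"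
    "\<And>k. k < i \<Longrightarrow> L (Suc k) \<subset> L k" "scale_lattice (1 / fls_X_inv) (L 0) \<subset> L i"
    using S unfolding simplices_def by blast
  have "inj ((*v) g)"
    using g unfolding invertible_def by (metis matrix_left_invertible_injective)
  then have strict: "(*v) g ` A \<subset> (*v) g ` B" if "A \<subset> B" for A B
    using that by (meson image_strict_mono inj_on_subset subset_UNIV)
  have "act (pgl_class g) ` S = (\<lambda>k. lattice_class ((*v) g ` L k)) ` {..i}"
    unfolding L(1) image_image act_class ..
  moreover have "scale_lattice (1 / fls_X_inv) ((*v) g ` L 0) \<subset> (*v) g ` L i"
    unfolding scale_lattice_image using L(4) by (rule strict)
  moreover have "\<forall>k\<le>i. is_lattice ((*v) g ` L k)" "\<forall>k<i. (*v) g ` L (Suc k) \<subset> (*v) g ` L k"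
    by (simp_all add: is_lattice_image[OF g] L(2) strict[OF L(3)])
  ultimately show ?thesis
    unfolding simplices_def by (intro CollectI exI[of _ i] exI[of _ "\<lambda>k. (*v) g ` L k"] conjI)
qed

lemma PGL_polyE:
  assumes "\<gamma> \<in> PGL_poly"
  obtains G where "invertible G" "invertible (poly_matrix G)" "\<gamma> = pgl_class (poly_matrix G)"
proof -
  obtain G where "invertible G" "\<gamma> = pgl_class (poly_matrix G)"
    using assms unfolding PGL_poly_def poly_matrix_def by blast
  then show thesis
    using that invertible_poly_matrix by blast
qed

lemma PGL_polyI: "invertible G \<Longrightarrow> pgl_class (poly_matrix G) \<in> PGL_poly"
  unfolding PGL_poly_def poly_matrix_def by blast

section \<open>Covering of vertices and simplices by translates\<close>

lemma std_vertices_subset_vertices: "std_vertices \<subseteq> vertices"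
  unfolding std_vertices_def vertices_def using is_lattice_std_lattice by auto

lemma act_vertices:
  assumes "invertible g" "v \<in> vertices"
  shows "act (pgl_class g) v \<in> vertices"
  using assms unfolding vertices_def by (auto simp: act_class is_lattice_image)

text \<open>A single lattice is a chain with \<open>i = 0\<close>: (1/t) \<open>L\<close> lies in
  \<open>L\<close> because 1/t is integral. So the standard form of chains applies.\<close>

lemma vertices_cover:
  "vertices = (\<Union>\<gamma>\<in>PGL_poly. act \<gamma> ` (std_vertices :: ('a::field fls ^ 'd::{finite,linorder}) set set set))"
proof (intro set_eqI iffI)
  fix v :: "('a fls, 'd) vec set set" assume "v \<in> vertices"
  then obtain L where L: "is_lattice L" "v = lattice_class L"
    unfolding vertices_def by blast
  have sub: "scale_lattice (1 / fls_X_inv) L \<subseteq> L"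
    using Omod.subspace_scale[OF is_lattice_subspace[OF L(1)], of _ fps_X]
    by (auto simp: scale_lattice_def fls_inverse_X_inv divide_inverse simp del: fls_divide_X_inv)
  obtain G n where G: "invertible G" "antimono n" "L = (*v) (poly_matrix G) ` std_lattice n"
  proof (rule lattice_chain_standard_form[of 0 "\<lambda>_. L", OF L(1) subset_refl sub])
    fix G and n :: "nat \<Rightarrow> 'd \<Rightarrow> int"
    assume "invertible G" "\<And>k. antimono (n k)"
      "\<And>k. k \<le> 0 \<Longrightarrow> L = (*v) (poly_matrix G) ` std_lattice (n k)"
    then show thesis
      by (intro that[of G "n 0"]) simp_all
  qed
  then have "v = act (pgl_class (poly_matrix G)) (lattice_class (std_lattice n))"
    using L(2) by (simp add: act_class)
  then show "v \<in> (\<Union>\<gamma>\<in>PGL_poly. act \<gamma> ` std_vertices)"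
    using PGL_polyI[OF G(1)] lattice_class_std_lattice[OF G(2)] by blast
next
  fix v :: "('a fls, 'd) vec set set" assume "v \<in> (\<Union>\<gamma>\<in>PGL_poly. act \<gamma> ` std_vertices)"
  then show "v \<in> vertices"
    using act_vertices std_vertices_subset_vertices by (auto elim!: PGL_polyE)
qed

text \<open>The standard form of a representing chain gives \<gamma> and the set \<open>S'\<close>
  of standard vertices. That \<open>S'\<close> is a simplex follows by applying the inverse matrix
  to \<open>S\<close>.\<close>

lemma simplex_standard_form:
  assumes "S \<in> simplices"
  obtains \<gamma> and S' :: "('a::field fls, 'd::{finite,linorder}) vec set set set"
  where "\<gamma> \<in> PGL_poly" "S' \<in> simplices_in std_vertices" "S = act \<gamma> ` S'"
proof -
  obtain i L where L: "S = (\<lambda>k. lattice_class (L k)) ` {..i}" "\<And>k. k \<le> i \<Longrightarrow> is_lattice (L k)"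
    "\<And>k. k < i \<Longrightarrow> L (Suc k) \<subset> L k" "scale_lattice (1 / fls_X_inv) (L 0) \<subset> L i"
    using assms unfolding simplices_def by blast
  then obtain G n where G: "invertible G" "\<And>k. antimono (n k)"
    "\<And>k. k \<le> i \<Longrightarrow> L k = (*v) (poly_matrix G) ` std_lattice (n k)"
    using lattice_chain_standard_form[of i L] by (metis psubset_imp_subset)
  obtain H where H: "G ** H = mat 1" "H ** G = mat 1"
    using G(1) unfolding invertible_def by blast
  define S' where "S' = (\<lambda>k. lattice_class (std_lattice (n k) :: ('a fls, 'd) vec set)) ` {..i}"
  have S: "S = act (pgl_class (poly_matrix G)) ` S'"
    unfolding S'_def L(1) image_image act_class using G(3) by (intro image_cong) auto
  have "act (pgl_class (poly_matrix H)) ` S = S'"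
    unfolding S S'_def image_image
    by (intro image_cong act_pgl_class_cancel) (simp_all add: H poly_matrix_one flip: poly_matrix_mult)
  moreover have "invertible (poly_matrix H)"
    using H by (intro invertible_poly_matrix) (auto simp: invertible_def)
  ultimately have "S' \<in> simplices"
    using act_simplex assms by metis
  moreover have "S' \<subseteq> std_vertices"
    unfolding S'_def using lattice_class_std_lattice G(2) by auto
  ultimately show thesis
    using that PGL_polyI G(1) S unfolding simplices_in_def by blast
qed

text \<open>Two standard vertices in one orbit have the same exponents by
  \<open>std_lattice_class_unique\<close>.\<close>

lemma act_std_vertex_eq:
  assumes "\<gamma> \<in> PGL_poly" "v \<in> std_vertices" "act \<gamma> v \<in> std_vertices"
  shows "act \<gamma> v = v"
proof -
  obtain G where G: "invertible G" "\<gamma> = pgl_class (poly_matrix G)"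
    using assms(1) by (rule PGL_polyE)
  obtain n where n: "v = lattice_class (std_lattice n)" "antimono n" "n (Max UNIV) = 0"
    using assms(2) unfolding std_vertices_def by blast
  obtain m where m: "act \<gamma> v = lattice_class (std_lattice m)" "antimono m" "m (Max UNIV) = 0"
    using assms(3) unfolding std_vertices_def by blast
  have "n = m"
    using m(1) unfolding n(1) G(2) act_class by (rule std_lattice_class_unique[OF G(1) _ n(2,3) m(2,3)])
  then show ?thesis
    using n(1) m(1) by simp
qed

section \<open>Open simplices and the action on points\<close>

lemma open_simplex_inj: "x \<in> open_simplex S \<Longrightarrow> x \<in> open_simplex T \<Longrightarrow> S = T"
proof -
  \<comment> \<open>The simplex is recovered as the support of the point.\<close>
  have "S = {v. x v \<noteq> 0}" if "x \<in> open_simplex S" for S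
    using that less_irrefl unfolding open_simplex_def by fastforce
  then show "x \<in> open_simplex S \<Longrightarrow> x \<in> open_simplex T \<Longrightarrow> S = T"
    by metis
qed

context
  fixes \<gamma> :: "('a::field fls ^ 'd ^ 'd::finite) set" and S :: "('a fls ^ 'd) set set set"
  assumes inj: "inj_on (act \<gamma>) S"
begin

text \<open>Injectivity on \<open>S\<close> leaves only \<open>v\<close> in the part of the support
  of \<open>x\<close> over \<open>act \<gamma> v\<close>, so the sum has one term.\<close>

lemma act_point_act:
  assumes "x \<in> open_simplex S" "v \<in> S"
  shows "act_point \<gamma> x (act \<gamma> v) = x v"
proof -
  have "u \<in> S" if "x u \<noteq> 0" for u
    using that assms(1) unfolding open_simplex_def by blast
  moreover have "x v \<noteq> 0"
    using assms unfolding open_simplex_def by fastforce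
  ultimately have "{u. x u \<noteq> 0 \<and> act \<gamma> u = act \<gamma> v} = {v}"
    using inj_onD[OF inj _ _ assms(2)] by blast
  then show ?thesis
    by (simp add: act_point_def)
qed

lemma act_point_outside:
  assumes "x \<in> open_simplex S" "w \<notin> act \<gamma> ` S"
  shows "act_point \<gamma> x w = 0"
proof -
  have "{u. x u \<noteq> 0 \<and> act \<gamma> u = w} = {}"
    using assms unfolding open_simplex_def by blast
  then show ?thesis
    unfolding act_point_def by (simp only: sum.empty)
qed

lemma act_point_open_simplex: "act_point \<gamma> ` open_simplex S = open_simplex (act \<gamma> ` S)"
proof (intro set_eqI iffI)
  fix y assume "y \<in> act_point \<gamma> ` open_simplex S"
  then obtain x where x: "x \<in> open_simplex S" "y = act_point \<gamma> x"
    by blast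
  then show "y \<in> open_simplex (act \<gamma> ` S)"
    using act_point_act[OF x(1)] act_point_outside[OF x(1)] inj
    by (auto simp: open_simplex_def sum.reindex)
next
  fix y assume y: "y \<in> open_simplex (act \<gamma> ` S)"
  \<comment> \<open>The preimage of \<open>y\<close> arises by pulling its coordinates back along
    \<open>act \<gamma>\<close>.\<close>
  define x where "x v = (if v \<in> S then y (act \<gamma> v) else 0)" for v
  have x: "x \<in> open_simplex S"
    using y inj by (auto simp: open_simplex_def x_def sum.reindex)
  have "act_point \<gamma> x w = y w" for w
  proof (cases "w \<in> act \<gamma> ` S")
    case True
    then show ?thesis
      using act_point_act[OF x] by (auto simp: x_def)
  next
    case False
    then show ?thesis
      using act_point_outside[OF x] y by (simp add: open_simplex_def)
  qed
  then have "y = act_point \<gamma> x"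
    by auto
  with x show "y \<in> act_point \<gamma> ` open_simplex S"
    by blast
qed

end

lemma inj_on_act_simplex:
  assumes "\<gamma> \<in> PGL_poly" "S \<in> simplices"
  shows "inj_on (act \<gamma>) S"
proof -
  obtain G where "invertible (poly_matrix G)" "\<gamma> = pgl_class (poly_matrix G)"
    using assms(1) by (rule PGL_polyE)
  then show ?thesis
    using inj_on_act inj_on_subset simplices_subset_vertices[OF assms(2)] by blast
qed

text \<open>Since open simplices are carried onto open simplices, the claim reduces to simplices,
  where \<open>act_simplex\<close> gives one inclusion and \<open>simplex_standard_form\<close> the
  other.\<close>

lemma realization_cover:
  "realization simplices = (\<Union>\<gamma>\<in>PGL_poly. act_point \<gamma> `
    realization (simplices_in (std_vertices :: ('a::field fls ^ 'd::{finite,linorder}) set set set)))"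
proof -
  let ?T = "simplices_in (std_vertices :: ('a fls, 'd) vec set set set)"
  have "(\<Union>\<gamma>\<in>PGL_poly. act_point \<gamma> ` realization ?T) =
      (\<Union>\<gamma>\<in>PGL_poly. \<Union>S\<in>?T. open_simplex (act \<gamma> ` S))"
  proof (intro SUP_cong refl)
    fix \<gamma> :: "(('a fls, 'd) vec, 'd) vec set" assume \<gamma>: "\<gamma> \<in> PGL_poly"
    have "act_point \<gamma> ` open_simplex S = open_simplex (act \<gamma> ` S)" if "S \<in> ?T" for S
      using that \<gamma> by (intro act_point_open_simplex inj_on_act_simplex) (simp_all add: simplices_in_def)
    then show "act_point \<gamma> ` realization ?T = (\<Union>S\<in>?T. open_simplex (act \<gamma> ` S))"
      unfolding realization_def image_UN by (rule SUP_cong[OF refl])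
  qed
  also have "\<dots> = (\<Union>S\<in>simplices. open_simplex S)"
  proof
    have "act \<gamma> ` S \<in> simplices" if "\<gamma> \<in> PGL_poly" "S \<in> ?T" for \<gamma> S
      using that act_simplex by (auto simp: simplices_in_def elim!: PGL_polyE)
    then show "(\<Union>\<gamma>\<in>PGL_poly. \<Union>S\<in>?T. open_simplex (act \<gamma> ` S)) \<subseteq> (\<Union>S\<in>simplices. open_simplex S)"
      by blast
    show "(\<Union>S\<in>simplices. open_simplex S) \<subseteq> (\<Union>\<gamma>\<in>PGL_poly. \<Union>S\<in>?T. open_simplex (act \<gamma> ` S))"
    proof
      fix x :: "('a fls, 'd) vec set set \<Rightarrow> real" assume "x \<in> (\<Union>S\<in>simplices. open_simplex S)"
      then obtain S where S: "S \<in> simplices" "x \<in> open_simplex S"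
        by blast
      from S(1) obtain \<gamma> S' where "\<gamma> \<in> PGL_poly" "S' \<in> ?T" "S = act \<gamma> ` S'"
        by (rule simplex_standard_form)
      with S(2) show "x \<in> (\<Union>\<gamma>\<in>PGL_poly. \<Union>S\<in>?T. open_simplex (act \<gamma> ` S))"
        by blast
    qed
  qed
  finally show ?thesis
    unfolding realization_def by (rule sym)
qed

theorem proposition5p2:
  assumes "CARD('d::{finite,linorder}) \<ge> 2"
  shows "is_fundamental_domain PGL_poly (std_vertices :: ('a::{field,finite} fls ^ 'd::{finite,linorder}) set set set)"
  unfolding is_fundamental_domain_def
proof (intro conjI ballI impI)
  show "vertices = (\<Union>\<gamma>\<in>PGL_poly. act \<gamma> ` (std_vertices :: ('a fls, 'd) vec set set set))"
    by (rule vertices_cover)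
  show "realization simplices = (\<Union>\<gamma>\<in>PGL_poly. act_point \<gamma> `
      realization (simplices_in (std_vertices :: ('a fls, 'd) vec set set set)))"
    by (rule realization_cover)
  fix S :: "('a fls, 'd) vec set set set" and \<gamma> :: "(('a fls, 'd) vec, 'd) vec set"
  assume S: "S \<in> simplices_in std_vertices" and \<gamma>: "\<gamma> \<in> PGL_poly"
  then have simplex: "S \<in> simplices" and std: "S \<subseteq> std_vertices"
    unfolding simplices_in_def by auto
  have inj: "inj_on (act \<gamma>) S"
    using \<gamma> simplex by (rule inj_on_act_simplex)
  show fix_vertices: "act \<gamma> v = v" if "v \<in> S" "act \<gamma> v \<in> S" for v
    using act_std_vertex_eq[OF \<gamma>] std that by blast
  show "act_point \<gamma> ` open_simplex S \<inter> open_simplex S = {} \<or>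
      act_point \<gamma> ` open_simplex S = open_simplex S \<and> (\<forall>x\<in>open_simplex S. act_point \<gamma> x = x)"
  proof (cases "act_point \<gamma> ` open_simplex S \<inter> open_simplex S = {}")
    case False
    \<comment> \<open>Open simplices that meet are equal, so \<gamma> permutes the vertices of
      \<open>S\<close>.\<close>
    then have image: "act \<gamma> ` S = S"
      unfolding act_point_open_simplex[OF inj] using open_simplex_inj by blast
    then have "act_point \<gamma> ` open_simplex S = open_simplex S"
      unfolding act_point_open_simplex[OF inj] by simp
    moreover have fixed: "act \<gamma> v = v" if "v \<in> S" for v
    proof (rule fix_vertices[OF that])
      show "act \<gamma> v \<in> S"
        using imageI[OF that, of "act \<gamma>"] image by simp
    qed
    moreover have "act_point \<gamma> x = x" if x: "x \<in> open_simplex S" for x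
    proof
      fix w
      show "act_point \<gamma> x w = x w"
      proof (cases "w \<in> S")
        case True
        then show ?thesis
          using act_point_act[OF inj x True] fixed by simp
      next
        case False
        then show ?thesis
          using act_point_outside[OF inj x, of w] image x by (simp add: open_simplex_def)
      qed
    qed
    ultimately show ?thesis by blast
  qed simp
qed

end
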